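(* Let $\mu>0$, let $f\in C^2_0(\mathbb{R})$ and $g\in C^1_0(\mathbb{R})$, and let $u(x,t)$ be the solution to the Cauchy problem for the damped wave equation $$ \begin{cases} \mu u_t+u_{tt}-u_{xx}=0, & x\in\mathbb{R},\ t>0,\\ u(x,0)=f(x), & x\in\mathbb{R},\\ u_t(x,0)=g(x), & x\in\mathbb{R}. \end{cases} $$ Then, for every $x\in\mathbb{R}$, $$ \lim_{t\to\infty}\sqrt{t}\,u(\sqrt{t}\,x,t)=M f^*_\mu(x), $$ where $$ M=\int_{\mathbb{R}}\left[f(y)+\frac{1}{\mu}g(y)\right]dy \qquad\text{and}\qquad f^*_\mu(x)=\sqrt{\frac{\mu}{4\pi}}\,e^{-\mu x^2/4}. $$
   Context: $C^k_0(\mathbb{R})$ denotes the space of real-valued, $k$ times continuously differentiable functions on $\mathbb{R}$ with compact support. The solution $u$ is the (unique) classical real-valued solution of the Cauchy problem. The limit is taken for each fixed $x\in\mathbb{R}$. *)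

theory Defs
  imports "HOL-Analysis.Analysis"
begin

fun C_k :: "nat \<Rightarrow> (real \<Rightarrow> real) \<Rightarrow> bool" where
  "C_k 0 f \<longleftrightarrow> continuous_on UNIV f"
| "C_k (Suc k) f \<longleftrightarrow> f differentiable_on UNIV \<and> C_k k (deriv f)"

definition C_k_compact :: "nat \<Rightarrow> (real \<Rightarrow> real) set" where
  "C_k_compact k = {f. C_k k f \<and> compact (closure (support_on UNIV f))}"

text \<open>Functions on the closed half-plane \<open>t \<ge> 0\<close> are curried functions \<open>u x t\<close> whose values
  for \<open>t < 0\<close> are ignored: the time derivative is taken within \<open>{0..}\<close>, so it is one-sided
  at \<open>t = 0\<close> and the ordinary two-sided derivative for \<open>t > 0\<close>.\<close>

definition dx :: "(real \<Rightarrow> real \<Rightarrow> real) \<Rightarrow> real \<Rightarrow> real \<Rightarrow> real" where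
  "dx u x t = deriv (\<lambda>y. u y t) x"

definition dt :: "(real \<Rightarrow> real \<Rightarrow> real) \<Rightarrow> real \<Rightarrow> real \<Rightarrow> real" where
  "dt u x t = vector_derivative (\<lambda>s. u x s) (at t within {0..})"

fun C_k_halfplane :: "nat \<Rightarrow> (real \<Rightarrow> real \<Rightarrow> real) \<Rightarrow> bool" where
  "C_k_halfplane 0 u \<longleftrightarrow> continuous_on (UNIV \<times> {0..}) (\<lambda>(x, t). u x t)"
| "C_k_halfplane (Suc k) u \<longleftrightarrow>
     continuous_on (UNIV \<times> {0..}) (\<lambda>(x, t). u x t) \<and>
     (\<forall>x. \<forall>t\<ge>0. (\<lambda>y. u y t) differentiable (at x) \<and>
                  (\<lambda>s. u x s) differentiable (at t within {0..})) \<and>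
     C_k_halfplane k (dx u) \<and> C_k_halfplane k (dt u)"

text \<open>A classical solution is twice continuously differentiable up to the initial line.\<close>

definition damped_wave_solution ::
  "real \<Rightarrow> (real \<Rightarrow> real) \<Rightarrow> (real \<Rightarrow> real) \<Rightarrow> (real \<Rightarrow> real \<Rightarrow> real) \<Rightarrow> bool" where
  "damped_wave_solution \<mu> f g u \<longleftrightarrow>
     C_k_halfplane 2 u \<and>
     (\<forall>x. \<forall>t>0. \<mu> * dt u x t + dt (dt u) x t - dx (dx u) x t = 0) \<and>
     (\<forall>x. u x 0 = f x) \<and>
     (\<forall>x. dt u x 0 = g x)"

definition f_star :: "real \<Rightarrow> real \<Rightarrow> real" where
  "f_star \<mu> x = sqrt (\<mu> / (4 * pi)) * exp (- (\<mu> * x\<^sup>2 / 4))"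

end

theory Submission
  imports Defs "HOL-Probability.Characteristic_Functions"
begin

text \<open>With \<open>a = \<mu> / 2\<close> and \<open>w = exp (a t) u\<close>, the damped wave equation becomes the Klein-Gordon
  equation \<open>w\<^sub>t\<^sub>t = w\<^sub>x\<^sub>x + a\<^sup>2 w\<close> (with the unstable sign). Riemann's method
  (\<open>riemann_representation\<close>) expresses any classical solution through its data and the
  kernel \<open>K(x, t) = I\<^sub>0(a \<surd>(t\<^sup>2 - x\<^sup>2))\<close>:
  \<open>2 w(x, t) = f(x + t) + f(x - t) + \<integral> (g + a f)(z) K(x - z, t) + f(z) K\<^sub>t(x - z, t) dz\<close>,
  the integral being over \<open>{x - t..x + t}\<close>. At the points \<open>(\<surd>t x, t)\<close> and for large \<open>t\<close>, that interval
  covers the support of the data and the two boundary terms vanish.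

  It remains to find the behaviour of \<open>\<surd>t exp (- a t) K(\<surd>t x - z, t)\<close>. The kernel is
  the integral of \<open>exp (a t cos \<theta>) cos (a x sin \<theta>) / (2 \<pi>)\<close> over a period, and Laplace's method, with
  \<open>\<theta> = \<phi> / \<surd>t\<close>, gives the limit
  \<open>\<integral> exp (- a \<phi>\<^sup>2 / 2) cos (a x \<phi>) d\<phi> / (2 \<pi>) = exp (- a x\<^sup>2 / 2) / \<surd>(2 \<pi> a)\<close> (\<open>bessel_kernel_asymptotics\<close>).
  It does not depend on \<open>z\<close>. A derivative in \<open>t\<close> inserts a factor \<open>a cos \<theta>\<close>, which tends to \<open>a\<close>. By
  dominated convergence in \<open>z\<close>, \<open>\<surd>t u(\<surd>t x, t)\<close> therefore tends to half of
  \<open>exp (- a x\<^sup>2 / 2) / \<surd>(2 \<pi> a)\<close> times \<open>\<integral> (g + 2 a f) = \<mu> M\<close>, which is \<open>M f\<^sup>*\<^sub>\<mu>(x)\<close>: all that the limit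
  sees of the data is this total mass.\<close>

section \<open>Calculus on the half-plane\<close>

text \<open>The chain rule along a line of the half-plane. Continuity of one of the two partial
  derivatives suffices for total differentiability.\<close>

lemma has_real_derivative_along_line:
  fixes F F\<^sub>y F\<^sub>s :: "real \<Rightarrow> real \<Rightarrow> real"
  assumes Fy: "\<And>y s. s > 0 \<Longrightarrow> ((\<lambda>z. F z s) has_real_derivative F\<^sub>y y s) (at y)"
    and Fs: "\<And>y s. s > 0 \<Longrightarrow> (F y has_real_derivative F\<^sub>s y s) (at s)"
    and cont: "continuous_on (UNIV \<times> {0<..}) (\<lambda>(y, s). F\<^sub>s y s)"
    and s: "s > 0"
  shows "((\<lambda>s. F (c + v * s) s) has_real_derivative
           (v * F\<^sub>y (c + v * s) s + F\<^sub>s (c + v * s) s)) (at s)"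
proof -
  let ?y = "c + v * s"
  have op: "open (UNIV \<times> {0<..} :: (real \<times> real) set)"
    by (intro open_Times) auto
  have mem: "(?y, s) \<in> UNIV \<times> {0<..}"
    using s by simp
  have "((\<lambda>(y, s). F y s) has_derivative
          (\<lambda>(ty, ts). ty * F\<^sub>y ?y s + blinfun_mult_right (F\<^sub>s ?y s) ts))
        (at (?y, s) within UNIV \<times> {0<..})"
  proof (rule has_derivative_partialsI)
    show "((\<lambda>y. F y s) has_derivative (\<lambda>h. h * F\<^sub>y ?y s)) (at ?y within UNIV)"
      using Fy[OF s, of ?y] by (simp add: has_field_derivative_def mult_commute_abs)
    show "(F y has_derivative blinfun_apply (blinfun_mult_right (F\<^sub>s y s'))) (at s' within {0<..})"
      if "s' \<in> {0<..}" for y s'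
      using Fs[of s' y] that
      by (auto simp: has_field_derivative_def intro: has_derivative_at_withinI)
    have "continuous_on (UNIV \<times> {0<..}) (\<lambda>p. blinfun_mult_right ((\<lambda>(y, s). F\<^sub>s y s) p))"
      by (intro bounded_linear.continuous_on[OF bounded_linear_blinfun_mult_right] cont)
    then show "continuous (at (?y, s) within UNIV \<times> {0<..}) (\<lambda>(y, s). blinfun_mult_right (F\<^sub>s y s))"
      using mem by (simp add: continuous_on_eq_continuous_within case_prod_beta')
  qed (use s in auto)
  then have D: "((\<lambda>(y, s). F y s) has_derivative (\<lambda>(ty, ts). ty * F\<^sub>y ?y s + F\<^sub>s ?y s * ts)) (at (?y, s))"
    by (simp add: at_within_open[OF mem op])
  have L: "((\<lambda>s. (c + v * s, s)) has_derivative (\<lambda>h. (v * h, h))) (at s)"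
    by (auto intro!: derivative_eq_intros)
  have "((\<lambda>s. F (c + v * s) s) has_derivative (\<lambda>h. v * h * F\<^sub>y ?y s + F\<^sub>s ?y s * h)) (at s)"
    using has_derivative_compose[OF L D] by simp
  then show ?thesis
    unfolding has_field_derivative_def
    by (rule has_derivative_eq_rhs) (auto simp: fun_eq_iff algebra_simps)
qed

text \<open>The Poincare lemma for the form \<open>A dy + B ds\<close>, which is closed because
  \<open>A\<^sub>s = C = B\<^sub>y\<close>. The potential is \<open>P y s = (\<integral>\<^sub>0\<^sup>s B y \<sigma> d\<sigma>) + (\<integral>\<^sub>0\<^sup>y A z 0 dz)\<close>: integrating first along the
  initial line and then in time keeps the path inside the closed half-plane and makes the
  increments of \<open>P\<close> on the initial line integrals of \<open>A\<close> by construction. The third conclusion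
  is continuity down to the initial line in every direction in which \<open>P\<close> will be followed.\<close>

lemma closed_form_potential:
  fixes A B C :: "real \<Rightarrow> real \<Rightarrow> real"
  assumes contA: "continuous_on UNIV (\<lambda>y. A y 0)"
    and contA': "\<And>y. continuous_on {0..} (A y)"
    and contB: "continuous_on (UNIV \<times> {0..}) (\<lambda>(y, s). B y s)"
    and contC: "continuous_on (UNIV \<times> {0..}) (\<lambda>(y, s). C y s)"
    and As: "\<And>y s. s > 0 \<Longrightarrow> (A y has_real_derivative C y s) (at s)"
    and By: "\<And>y s. s \<ge> 0 \<Longrightarrow> ((\<lambda>z. B z s) has_real_derivative C y s) (at y)"
  obtains P where
    "\<And>y s. s > 0 \<Longrightarrow> ((\<lambda>z. P z s) has_real_derivative A y s) (at y)"
    "\<And>y s. s > 0 \<Longrightarrow> (P y has_real_derivative B y s) (at s)"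
    "\<And>c v. ((\<lambda>s. P (c + v * s) s) \<longlongrightarrow> P c 0) (at_right 0)"
    "\<And>y y'. y \<le> y' \<Longrightarrow> P y' 0 - P y 0 = integral {y..y'} (\<lambda>z. A z 0)"
proof
  \<comment> \<open>A signed primitive of \<open>A\<close> on the initial line, normalised at \<open>0\<close>.\<close>
  define Q where "Q y = (if 0 \<le> y then integral {0..y} (\<lambda>z. A z 0) else - integral {y..0} (\<lambda>z. A z 0))" for y
  define P where "P y s = integral {0..s} (B y) + Q y" for y s
  have contAi: "continuous_on {a..b} (\<lambda>z. A z 0)" for a b
    by (rule continuous_on_subset[OF contA]) auto
  have contBs: "continuous_on {0..s} (B y)" for y s
    by (rule continuous_on_compose2[OF contB, of _ "\<lambda>s. (y, s)", simplified])
       (auto intro!: continuous_intros)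
  have Qdiff: "Q y' - Q y = integral {y..y'} (\<lambda>z. A z 0)" if "y \<le> y'" for y y'
  proof -
    have comb: "integral {a..c} (\<lambda>z. A z 0) + integral {c..b} (\<lambda>z. A z 0) = integral {a..b} (\<lambda>z. A z 0)"
      if "a \<le> c" "c \<le> b" for a b c
      using that by (intro Henstock_Kurzweil_Integration.integral_combine integrable_continuous_real contAi)
    show ?thesis
      using that comb[of 0 y y'] comb[of y y' 0] comb[of y 0 y'] by (auto simp: Q_def)
  qed
  have Qder: "(Q has_real_derivative A y 0) (at y)" for y
  proof -
    have "((\<lambda>u. integral {y - 1..u} (\<lambda>z. A z 0)) has_real_derivative A y 0) (at y within {y - 1..y + 1})"
      by (rule integral_has_real_derivative[OF contAi]) auto
    then have "((\<lambda>u. integral {y - 1..u} (\<lambda>z. A z 0)) has_real_derivative A y 0) (at y)"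
      by (subst (asm) at_within_interior) auto
    from DERIV_add[OF DERIV_const[of "Q (y - 1)"] this]
    have "((\<lambda>u. Q (y - 1) + integral {y - 1..u} (\<lambda>z. A z 0)) has_real_derivative A y 0) (at y)"
      by simp
    note der = this
    have "Q (y - 1) + integral {y - 1..u} (\<lambda>z. A z 0) = Q u" if "u \<in> {y - 1<..}" for u
      using Qdiff[of "y - 1" u] that by simp
    then show ?thesis
      by (intro has_field_derivative_transform_within_open[OF der, of "{y - 1<..}"]) auto
  qed
  show "((\<lambda>z. P z s) has_real_derivative A y s) (at y)" if s: "s > 0" for y s
  proof -
    have "((\<lambda>z. integral (cbox 0 s) (B z)) has_real_derivative integral (cbox 0 s) (C y)) (at y within UNIV)"
    proof (rule leibniz_rule_field_derivative)
      show "B x integrable_on cbox 0 s" for x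
        using contBs by (auto intro!: integrable_continuous_real)
      show "continuous_on (UNIV \<times> cbox 0 s) (\<lambda>(x, t). C x t)"
        by (rule continuous_on_subset[OF contC]) auto
    qed (use By in auto)
    moreover have "(C y has_integral (A y s - A y 0)) {0..s}"
    proof (rule fundamental_theorem_of_calculus_interior)
      show "continuous_on {0..s} (A y)"
        by (rule continuous_on_subset[OF contA']) auto
      show "(A y has_vector_derivative C y r) (at r)" if "r \<in> {0<..<s}" for r
        using As[of r y] that by (simp add: has_real_derivative_iff_has_vector_derivative)
    qed (use s in auto)
    ultimately show ?thesis
      unfolding P_def using Qder[of y]
      by (auto intro!: derivative_eq_intros dest!: integral_unique)
  qed
  show "(P y has_real_derivative B y s) (at s)" if s: "s > 0" for y s
  proof -
    have "((\<lambda>u. integral {0..u} (B y)) has_real_derivative B y s) (at s within {0..s + 1})"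
      by (rule integral_has_real_derivative[OF contBs]) (use s in auto)
    then have "((\<lambda>u. integral {0..u} (B y)) has_real_derivative B y s) (at s)"
      using s by (subst (asm) at_within_interior) auto
    from DERIV_add[OF this DERIV_const[of "Q y"]] show ?thesis
      unfolding P_def by simp
  qed
  show "((\<lambda>s. P (c + v * s) s) \<longlongrightarrow> P c 0) (at_right 0)" for c v
  proof -
    have "compact ((\<lambda>(y, s). B y s) ` ({c - \<bar>v\<bar>..c + \<bar>v\<bar>} \<times> {0..1}))"
      by (intro compact_continuous_image continuous_on_subset[OF contB] compact_Times) auto
    then obtain b where "\<forall>z \<in> (\<lambda>(y, s). B y s) ` ({c - \<bar>v\<bar>..c + \<bar>v\<bar>} \<times> {0..1}). norm z \<le> b"
      using compact_imp_bounded bounded_iff by metis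
    then have b: "\<bar>B y s\<bar> \<le> b" if "y \<in> {c - \<bar>v\<bar>..c + \<bar>v\<bar>}" "s \<in> {0..1}" for y s
      using that by force
    \<comment> \<open>The interval shrinks to a point while the integrand stays bounded on a compact strip.\<close>
    have "((\<lambda>s. integral {0..s} (B (c + v * s))) \<longlongrightarrow> 0) (at_right 0)"
    proof (rule Lim_null_comparison)
      show "\<forall>\<^sub>F s in at_right 0. norm (integral {0..s} (B (c + v * s))) \<le> b * (s - 0)"
        unfolding eventually_at_right_field
      proof (intro exI[of _ 1] conjI allI impI)
        fix s :: real assume s: "0 < s" "s < 1"
        have "\<bar>v * s\<bar> \<le> \<bar>v\<bar>" using s by (simp add: abs_mult mult_left_le)
        then show "norm (integral {0..s} (B (c + v * s))) \<le> b * (s - 0)"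
          using s by (intro integral_bound contBs) (auto intro!: b[unfolded real_norm_def] simp del: abs_le_iff)
      qed auto
      show "((\<lambda>s. b * (s - 0)) \<longlongrightarrow> 0) (at_right 0)"
        by (auto intro!: tendsto_eq_intros)
    qed
    moreover have "((\<lambda>s. Q (c + v * s)) \<longlongrightarrow> Q (c + v * 0)) (at_right 0)"
      using DERIV_isCont[OF Qder] by (intro isCont_tendsto_compose[where g = Q] tendsto_intros) auto
    ultimately show ?thesis
      unfolding P_def by (auto intro!: tendsto_eq_intros)
  qed
  show "P y' 0 - P y 0 = integral {y..y'} (\<lambda>z. A z 0)" if "y \<le> y'" for y y'
    using Qdiff[OF that] by (simp add: P_def)
qed

section \<open>The kernel of the Klein-Gordon equation\<close>

text \<open>Up to the factor \<open>a ^ (n + m)\<close> this is the derivative \<open>\<partial>\<^sub>t\<^sup>n \<partial>\<^sub>x\<^sup>m\<close> of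
  \<open>K(x, t) = I\<^sub>0(a \<surd>(t\<^sup>2 - x\<^sup>2))\<close>, where \<open>I\<^sub>0\<close> is the modified Bessel function; the formula is the
  real part of \<open>\<integral> exp (a (t cos \<theta> + \<i> x sin \<theta>)) d\<theta> / (2 \<pi>)\<close>, differentiated under the integral.
  The phase \<open>m \<pi> / 2\<close> makes a derivative in \<open>x\<close> a shift of the index \<open>m\<close>, just as a derivative in
  \<open>t\<close> is a shift of \<open>n\<close>. Unlike the formula with the square root, this one is visibly smooth across
  the light cone \<open>\<bar>x\<bar> = t\<close>, and it is ready for Laplace's method.\<close>
definition bessel_kernel :: "real \<Rightarrow> nat \<Rightarrow> nat \<Rightarrow> real \<Rightarrow> real \<Rightarrow> real" where
  "bessel_kernel a n m x t = integral {-pi..pi}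
     (\<lambda>\<theta>. cos \<theta> ^ n * sin \<theta> ^ m * exp (a * t * cos \<theta>) * cos (a * x * sin \<theta> + m * (pi / 2))) / (2 * pi)"

lemma bessel_kernel_has_derivative_t:
  "(bessel_kernel a n m x has_real_derivative a * bessel_kernel a (Suc n) m x t) (at t)"
proof -
  let ?f = "\<lambda>t \<theta>. cos \<theta> ^ n * sin \<theta> ^ m * exp (a * t * cos \<theta>) * cos (a * x * sin \<theta> + m * (pi / 2))"
  let ?g = "\<lambda>t \<theta>. a * (cos \<theta> ^ Suc n * sin \<theta> ^ m * exp (a * t * cos \<theta>) * cos (a * x * sin \<theta> + m * (pi / 2)))"
  have "((\<lambda>t. integral (cbox (-pi) pi) (?f t)) has_real_derivative integral (cbox (-pi) pi) (?g t)) (at t within UNIV)"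
  proof (rule leibniz_rule_field_derivative)
    show "((\<lambda>t. ?f t \<theta>) has_real_derivative ?g t \<theta>) (at t within UNIV)" for t \<theta>
      by (auto intro!: derivative_eq_intros simp: algebra_simps)
  qed (auto intro!: integrable_continuous_real continuous_intros simp: case_prod_beta')
  then have "((\<lambda>t. integral {-pi..pi} (?f t) / (2 * pi)) has_real_derivative integral {-pi..pi} (?g t) / (2 * pi)) (at t)"
    by (intro DERIV_cdivide) simp
  then show ?thesis
    unfolding bessel_kernel_def by simp
qed

lemma bessel_kernel_has_derivative_x:
  "((\<lambda>x. bessel_kernel a n m x t) has_real_derivative a * bessel_kernel a n (Suc m) x t) (at x)"
proof -
  let ?f = "\<lambda>x \<theta>. cos \<theta> ^ n * sin \<theta> ^ m * exp (a * t * cos \<theta>) * cos (a * x * sin \<theta> + m * (pi / 2))"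
  let ?g = "\<lambda>x \<theta>. a * (cos \<theta> ^ n * sin \<theta> ^ Suc m * exp (a * t * cos \<theta>) * cos (a * x * sin \<theta> + Suc m * (pi / 2)))"
  have shift: "cos (y + Suc m * (pi / 2)) = - sin (y + m * (pi / 2))" for y
    using minus_sin_cos_eq[of "y + m * (pi / 2)"] by (simp add: algebra_simps add_divide_distrib)
  have "((\<lambda>x. integral (cbox (-pi) pi) (?f x)) has_real_derivative integral (cbox (-pi) pi) (?g x)) (at x within UNIV)"
  proof (rule leibniz_rule_field_derivative)
    show "((\<lambda>x. ?f x \<theta>) has_real_derivative ?g x \<theta>) (at x within UNIV)" for x \<theta>
      unfolding shift by (auto intro!: derivative_eq_intros simp: algebra_simps)
  qed (auto intro!: integrable_continuous_real continuous_intros simp: case_prod_beta')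
  then have "((\<lambda>x. integral {-pi..pi} (?f x) / (2 * pi)) has_real_derivative integral {-pi..pi} (?g x) / (2 * pi)) (at x)"
    by (intro DERIV_cdivide) simp
  then show ?thesis
    unfolding bessel_kernel_def by simp
qed

lemma continuous_on_bessel_kernel [continuous_intros]:
  fixes X T :: "'a::topological_space \<Rightarrow> real"
  assumes "continuous_on S X" "continuous_on S T"
  shows "continuous_on S (\<lambda>p. bessel_kernel a n m (X p) (T p))"
proof -
  have "continuous_on UNIV (\<lambda>q::real \<times> real. integral (cbox (-pi) pi)
     (\<lambda>\<theta>. cos \<theta> ^ n * sin \<theta> ^ m * exp (a * snd q * cos \<theta>) * cos (a * fst q * sin \<theta> + m * (pi / 2))))"
    by (rule integral_continuous_on_param) (auto intro!: continuous_intros simp: case_prod_beta')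
  then have "continuous_on UNIV (\<lambda>(x, t). bessel_kernel a n m x t)"
    unfolding bessel_kernel_def case_prod_beta' by (auto intro!: continuous_intros)
  from continuous_on_compose2[OF this continuous_on_Pair[OF assms]] show ?thesis
    by simp
qed

lemma cos_add_half_pi: "cos (y + pi / 2) = - sin y" for y :: real
  by (simp add: cos_add)

text \<open>\<open>K\<^sub>t\<^sub>t - K\<^sub>x\<^sub>x = a\<^sup>2 K\<close>, with the powers of \<open>a\<close> divided out; under the integral it is
  \<open>cos\<^sup>2 + sin\<^sup>2 = 1\<close>.\<close>

lemma bessel_kernel_klein_gordon:
  "bessel_kernel a 2 0 x t - bessel_kernel a 0 2 x t = bessel_kernel a 0 0 x t"
proof -
  have pythagoras: "(cos \<theta>)\<^sup>2 * E * c + (sin \<theta>)\<^sup>2 * E * c = E * c" for E c \<theta> :: real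
    using sin_cos_squared_add2[of \<theta>] by (metis distrib_right mult_1)
  show ?thesis
    unfolding bessel_kernel_def diff_divide_distrib[symmetric]
    by (subst integral_diff[symmetric])
       (auto intro!: integrable_continuous_real continuous_intros integral_cong
          simp: pythagoras)
qed

text \<open>The kernel is constant along the light cone. The sum of the two integrands is the real
  part of \<open>z exp (a t z)\<close> at \<open>z = exp (\<i> \<theta>)\<close>, which is the derivative in \<open>\<theta>\<close> of the periodic function
  \<open>Im (exp (a t z)) / (a t)\<close>.\<close>

lemma bessel_kernel_characteristic:
  assumes "a * t \<noteq> 0"
  shows "bessel_kernel a 1 0 t t + bessel_kernel a 0 1 t t = 0"
proof -
  let ?h = "\<lambda>\<theta>. exp (a * t * cos \<theta>) * (cos \<theta> * cos (a * t * sin \<theta>) - sin \<theta> * sin (a * t * sin \<theta>))"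
  let ?H = "\<lambda>\<theta>. exp (a * t * cos \<theta>) * sin (a * t * sin \<theta>) / (a * t)"
  have "(?h has_integral (?H pi - ?H (-pi))) {-pi..pi}"
  proof (rule fundamental_theorem_of_calculus)
    show "(?H has_vector_derivative ?h \<theta>) (at \<theta> within {-pi..pi})" for \<theta>
      unfolding has_real_derivative_iff_has_vector_derivative[symmetric]
      using assms by (auto intro!: derivative_eq_intros simp: field_simps)
  qed auto
  then have "integral {-pi..pi} ?h = 0"
    by (simp add: integral_unique)
  moreover have "bessel_kernel a 1 0 t t + bessel_kernel a 0 1 t t = integral {-pi..pi} ?h / (2 * pi)"
    unfolding bessel_kernel_def add_divide_distrib[symmetric]
    by (subst integral_add[symmetric])
       (auto intro!: integrable_continuous_real continuous_intros integral_cong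
          simp: cos_add_half_pi cos_add_half_pi[unfolded add.commute[of _ "pi / 2"]] algebra_simps)
  ultimately show ?thesis
    by simp
qed

lemma bessel_kernel_reflect:
  "bessel_kernel a n 0 (- x) t = bessel_kernel a n 0 x t"
  "bessel_kernel a n 1 (- x) t = - bessel_kernel a n 1 x t"
  by (simp_all add: bessel_kernel_def cos_add_half_pi cos_diff)

lemma bessel_kernel_origin: "bessel_kernel a 0 0 0 0 = 1"
  by (simp add: bessel_kernel_def)

section \<open>Riemann's method\<close>

text \<open>Put \<open>R(y, s) = K(x - y, t - s)\<close>, a solution of the same equation as \<open>w\<close>. By Green's
  identity the form \<open>A dy + B ds\<close> with \<open>A = w\<^sub>s R - w R\<^sub>s\<close> and \<open>B = w\<^sub>y R - w R\<^sub>y\<close> is closed, so it has a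
  potential \<open>P\<close>. Since \<open>K\<close> is constant on the light cone, \<open>P + w R\<close> is constant along the
  characteristic from \<open>(x, t)\<close> to \<open>(x + t, 0)\<close>, and \<open>P - w R\<close> along the one to \<open>(x - t, 0)\<close>. The
  difference of the two identities cancels \<open>P(x, t)\<close> at the apex of the triangle, leaves
  \<open>2 w(x, t)\<close> there, and leaves data on its base. The argument applies to every classical
  solution and shows that the data determine it. The weight \<open>K(t, t) = I\<^sub>0(0)\<close> of the boundary
  values is \<open>1\<close>.\<close>
lemma riemann_representation:
  fixes w w\<^sub>x w\<^sub>t w\<^sub>x\<^sub>x w\<^sub>t\<^sub>t :: "real \<Rightarrow> real \<Rightarrow> real"
  assumes a: "a > 0"
    and cont: "continuous_on (UNIV \<times> {0..}) (\<lambda>(y, s). w y s)"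
      "continuous_on (UNIV \<times> {0..}) (\<lambda>(y, s). w\<^sub>x y s)"
      "continuous_on (UNIV \<times> {0..}) (\<lambda>(y, s). w\<^sub>t y s)"
      "continuous_on (UNIV \<times> {0..}) (\<lambda>(y, s). w\<^sub>x\<^sub>x y s)"
    and wx: "\<And>y s. s \<ge> 0 \<Longrightarrow> ((\<lambda>z. w z s) has_real_derivative w\<^sub>x y s) (at y)"
    and wxx: "\<And>y s. s \<ge> 0 \<Longrightarrow> ((\<lambda>z. w\<^sub>x z s) has_real_derivative w\<^sub>x\<^sub>x y s) (at y)"
    and wt: "\<And>y s. s > 0 \<Longrightarrow> (w y has_real_derivative w\<^sub>t y s) (at s)"
    and wtt: "\<And>y s. s > 0 \<Longrightarrow> (w\<^sub>t y has_real_derivative w\<^sub>t\<^sub>t y s) (at s)"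
    and klein_gordon: "\<And>y s. s > 0 \<Longrightarrow> w\<^sub>t\<^sub>t y s = w\<^sub>x\<^sub>x y s + a\<^sup>2 * w y s"
    and t: "t > 0"
  shows "2 * w x t =
    w (x + t) 0 * bessel_kernel a 0 0 t t + w (x - t) 0 * bessel_kernel a 0 0 t t +
    integral {x - t..x + t} (\<lambda>z. w\<^sub>t z 0 * bessel_kernel a 0 0 (x - z) t
                               + w z 0 * (a * bessel_kernel a 1 0 (x - z) t))"
proof -
  define R where "R n m y s = bessel_kernel a n m (x - y) (t - s)" for n m y s
  have R_y: "((\<lambda>y. R n m y s) has_real_derivative - (a * R n (Suc m) y s)) (at y)" for n m y s
    unfolding R_def
    by (rule DERIV_cong[OF DERIV_chain2[where f = "\<lambda>x. bessel_kernel a n m x (t - s)",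
              OF bessel_kernel_has_derivative_x]])
       (auto intro!: derivative_eq_intros)
  have R_s: "(R n m y has_real_derivative - (a * R (Suc n) m y s)) (at s)" for n m y s
    unfolding R_def
    by (rule DERIV_cong[OF DERIV_chain2[where f = "bessel_kernel a n m (x - y)",
              OF bessel_kernel_has_derivative_t]])
       (auto intro!: derivative_eq_intros)
  have R_cont: "continuous_on S (\<lambda>p. R n m (Y p) (T p))"
    if "continuous_on S Y" "continuous_on S T" for S :: "'c::topological_space set" and Y T n m
    unfolding R_def by (intro continuous_intros that)
  note cont' = cont[unfolded case_prod_beta']
  define A where "A y s = w\<^sub>t y s * R 0 0 y s + w y s * (a * R 1 0 y s)" for y s
  define B where "B y s = w\<^sub>x y s * R 0 0 y s + w y s * (a * R 0 1 y s)" for y s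
  define C where "C y s = w\<^sub>x\<^sub>x y s * R 0 0 y s - w y s * (a\<^sup>2 * R 0 2 y s)" for y s
  have slice_t: "continuous_on {0..} (h y)"
    if "continuous_on (UNIV \<times> {0..}) (\<lambda>(y, s). h y s)" for h :: "real \<Rightarrow> real \<Rightarrow> real" and y
    by (rule continuous_on_compose2[OF that, of _ "\<lambda>s. (y, s)", simplified])
       (auto intro!: continuous_intros)
  have slice_x: "continuous_on UNIV (\<lambda>y. h y 0)"
    if "continuous_on (UNIV \<times> {0..}) (\<lambda>(y, s). h y s)" for h :: "real \<Rightarrow> real \<Rightarrow> real"
    by (rule continuous_on_compose2[OF that, of _ "\<lambda>y. (y, 0)", simplified])
       (auto intro!: continuous_intros)
  have contA: "continuous_on (UNIV \<times> {0..}) (\<lambda>(y, s). A y s)"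
    unfolding A_def case_prod_beta' by (intro continuous_intros cont' R_cont)
  have contB: "continuous_on (UNIV \<times> {0..}) (\<lambda>(y, s). B y s)"
    unfolding B_def case_prod_beta' by (intro continuous_intros cont' R_cont)
  have contC: "continuous_on (UNIV \<times> {0..}) (\<lambda>(y, s). C y s)"
    unfolding C_def case_prod_beta' by (intro continuous_intros cont' R_cont)
  have As: "(A y has_real_derivative C y s) (at s)" if s: "s > 0" for y s
  proof -
    have kg: "R 2 0 y s = R 0 0 y s + R 0 2 y s"
      using bessel_kernel_klein_gordon[of a "x - y" "t - s"] by (simp add: R_def)
    show ?thesis
      unfolding A_def C_def
      by (rule DERIV_cong, (rule derivative_intros wt[OF s] wtt[OF s] R_s)+)
         (simp add: klein_gordon[OF s] kg numeral_2_eq_2[symmetric] power2_eq_square algebra_simps)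
  qed
  have By: "((\<lambda>z. B z s) has_real_derivative C y s) (at y)" if s: "s \<ge> 0" for y s
    unfolding B_def C_def
    by (rule DERIV_cong, (rule derivative_intros wx[OF s] wxx[OF s] R_y)+)
       (simp add: numeral_2_eq_2[symmetric] power2_eq_square algebra_simps)
  obtain P where
    Py: "\<And>y s. s > 0 \<Longrightarrow> ((\<lambda>z. P z s) has_real_derivative A y s) (at y)" and
    Ps: "\<And>y s. s > 0 \<Longrightarrow> (P y has_real_derivative B y s) (at s)" and
    P0: "\<And>c v. ((\<lambda>s. P (c + v * s) s) \<longlongrightarrow> P c 0) (at_right 0)" and
    Pint: "\<And>y y'. y \<le> y' \<Longrightarrow> P y' 0 - P y 0 = integral {y..y'} (\<lambda>z. A z 0)"
    using closed_form_potential[OF slice_x[OF contA] slice_t[OF contA] contB contC As By] by blast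
  have sub: "continuous_on (UNIV \<times> {0<..}) h" if "continuous_on (UNIV \<times> {0..}) h"
    for h :: "real \<times> real \<Rightarrow> real"
    by (rule continuous_on_subset[OF that]) auto
  \<comment> \<open>The sign \<open>\<sigma>\<close> selects the right or the left characteristic through \<open>(x, t)\<close>.\<close>
  have along: "P x t + \<sigma> * (w x t * R 0 0 x t) = P (x + \<sigma> * t) 0 + \<sigma> * (w (x + \<sigma> * t) 0 * R 0 0 (x + \<sigma> * t) 0)"
    if \<sigma>: "\<sigma> = 1 \<or> \<sigma> = -1" for \<sigma> :: real
  proof -
    define y where "y s = (x + \<sigma> * t) + (- \<sigma>) * s" for s
    define h where "h s = P (y s) s + \<sigma> * (w (y s) s * R 0 0 (y s) s)" for s
    have dP: "((\<lambda>s. P (y s) s) has_real_derivative (- \<sigma> * A (y s) s + B (y s) s)) (at s)" if "s > 0" for s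
      unfolding y_def by (rule has_real_derivative_along_line[OF Py Ps sub[OF contB] that])
    have dw: "((\<lambda>s. w (y s) s) has_real_derivative (- \<sigma> * w\<^sub>x (y s) s + w\<^sub>t (y s) s)) (at s)" if "s > 0" for s
      unfolding y_def by (rule has_real_derivative_along_line[OF wx wt sub[OF cont(3)] that]) auto
    have dR: "((\<lambda>s. R 0 0 (y s) s) has_real_derivative (- \<sigma> * - (a * R 0 1 (y s) s) + - (a * R 1 0 (y s) s))) (at s)"
      if "s > 0" for s
      unfolding y_def One_nat_def
      by (rule has_real_derivative_along_line[OF R_y R_s _ that])
         (auto simp: case_prod_beta' intro!: continuous_intros R_cont)
    \<comment> \<open>\<open>R\<^sub>s = \<sigma> R\<^sub>y\<close> on the characteristic, so all terms of the derivative of \<open>h\<close> cancel.\<close>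
    have char: "R 1 0 (y s) s = \<sigma> * R 0 1 (y s) s" if "s < t" for s
    proof -
      have "x - y s = - \<sigma> * (t - s)"
        by (simp add: y_def algebra_simps)
      then show ?thesis
        using \<sigma> bessel_kernel_characteristic[of a "t - s"] a that
          bessel_kernel_reflect(1)[of a 1 "t - s" "t - s"] bessel_kernel_reflect(2)[of a 0 "t - s" "t - s"]
        by (auto simp: R_def)
    qed
    have dh: "(h has_real_derivative 0) (at s)" if s: "0 < s" "s < t" for s
    proof (rule DERIV_cong)
      show "(h has_real_derivative (- \<sigma> * A (y s) s + B (y s) s) +
          \<sigma> * ((- \<sigma> * w\<^sub>x (y s) s + w\<^sub>t (y s) s) * R 0 0 (y s) s +
               (- \<sigma> * - (a * R 0 1 (y s) s) + - (a * R 1 0 (y s) s)) * w (y s) s)) (at s)"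
        unfolding h_def by (intro DERIV_add DERIV_cmult DERIV_mult dP dw dR s)
      show "(- \<sigma> * A (y s) s + B (y s) s) +
          \<sigma> * ((- \<sigma> * w\<^sub>x (y s) s + w\<^sub>t (y s) s) * R 0 0 (y s) s +
               (- \<sigma> * - (a * R 0 1 (y s) s) + - (a * R 1 0 (y s) s)) * w (y s) s) = 0"
        using \<sigma> unfolding A_def B_def char[OF s(2)] by (auto simp: algebra_simps)
    qed
    \<comment> \<open>The time derivatives are given only for \<open>s > 0\<close>, so continuity at \<open>0\<close> is a separate argument.\<close>
    have h_cont: "continuous_on {0..t} h"
      unfolding continuous_on_eq_continuous_within
    proof
      fix s assume s: "s \<in> {0..t}"
      show "continuous (at s within {0..t}) h"
      proof (cases "s = 0")
        case False
        have "(h has_real_derivative (- \<sigma> * A (y s) s + B (y s) s) +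
          \<sigma> * ((- \<sigma> * w\<^sub>x (y s) s + w\<^sub>t (y s) s) * R 0 0 (y s) s +
               (- \<sigma> * - (a * R 0 1 (y s) s) + - (a * R 1 0 (y s) s)) * w (y s) s)) (at s)"
          unfolding h_def using s False by (intro DERIV_add DERIV_cmult DERIV_mult dP dw dR) auto
        then show ?thesis
          using DERIV_isCont continuous_at_imp_continuous_at_within by blast
      next
        case True
        have "continuous_on {0..} y"
          unfolding y_def by (intro continuous_intros)
        moreover from this have "continuous_on {0..} (\<lambda>s. w (y s) s)"
          by (intro continuous_on_compose2[OF cont(1), of _ "\<lambda>s. (y s, s)", simplified])
             (auto intro!: continuous_intros)
        ultimately have "continuous_on {0..} (\<lambda>s. w (y s) s * R 0 0 (y s) s)"
          by (intro continuous_intros R_cont)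
        then have "((\<lambda>s. w (y s) s * R 0 0 (y s) s) \<longlongrightarrow> w (y 0) 0 * R 0 0 (y 0) 0) (at 0 within {0..})"
          by (auto simp: continuous_on)
        then have "((\<lambda>s. w (y s) s * R 0 0 (y s) s) \<longlongrightarrow> w (y 0) 0 * R 0 0 (y 0) 0) (at_right 0)"
          by (rule tendsto_within_subset) auto
        moreover have "((\<lambda>s. P (y s) s) \<longlongrightarrow> P (y 0) 0) (at_right 0)"
          using P0[of "x + \<sigma> * t" "- \<sigma>"] by (simp add: y_def)
        ultimately have "(h \<longlongrightarrow> h 0) (at_right 0)"
          unfolding h_def by (intro tendsto_add tendsto_mult_left)
        then show ?thesis
          using t by (simp add: True continuous_within at_within_Icc_at_right)
      qed
    qed
    have "h t = h 0"
      by (rule DERIV_isconst_end[OF t h_cont dh])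
    then show ?thesis
      by (simp add: h_def y_def)
  qed
  have "R 0 0 x t = 1" "R 0 0 (x + t) 0 = bessel_kernel a 0 0 t t" "R 0 0 (x - t) 0 = bessel_kernel a 0 0 t t"
    using bessel_kernel_reflect(1)[of a 0 t t] by (simp_all add: R_def bessel_kernel_origin)
  moreover have "integral {x - t..x + t} (\<lambda>z. A z 0) = P (x + t) 0 - P (x - t) 0"
    using Pint[of "x - t" "x + t"] t by simp
  ultimately show ?thesis
    using along[of 1] along[of "-1"] by (simp add: A_def R_def)
qed

section \<open>Large-time behaviour of the kernel\<close>

text \<open>The Fourier transform of a Gaussian, by rescaling the characteristic function of the
  standard normal distribution.\<close>
lemma gaussian_cos_integral:
  fixes a b :: real
  assumes a: "a > 0"
  shows "integrable lborel (\<lambda>\<phi>. exp (- (a * \<phi>\<^sup>2 / 2)))"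
    and "(LINT \<phi>|lborel. exp (- (a * \<phi>\<^sup>2 / 2)) * cos (b * \<phi>)) = sqrt (2 * pi / a) * exp (- (b\<^sup>2 / (2 * a)))"
proof -
  interpret real_distribution std_normal_distribution
    by (rule real_dist_normal_dist)
  define \<beta> where "\<beta> = b / sqrt a"
  have "integrable lborel (\<lambda>x. std_normal_density (0 + sqrt a * x))"
    using a by (intro lborel_integrable_real_affine) auto
  then have "integrable lborel (\<lambda>x. sqrt (2 * pi) * std_normal_density (0 + sqrt a * x))"
    by (rule integrable_mult_right)
  moreover have dens: "sqrt (2 * pi) * std_normal_density (0 + sqrt a * \<phi>) = exp (- (a * \<phi>\<^sup>2 / 2))" for \<phi>
    using a by (simp add: std_normal_density_def power_mult_distrib)
  ultimately show "integrable lborel (\<lambda>\<phi>. exp (- (a * \<phi>\<^sup>2 / 2)))"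
    by (simp only: dens)
  have "exp (- (\<beta>\<^sup>2 / 2)) = Re (CLINT x|std_normal_distribution. iexp (\<beta> * x))"
    using char_std_normal_distribution by (simp add: char_def fun_eq_iff)
  also have "\<dots> = (LINT x|std_normal_distribution. Re (iexp (\<beta> * x)))"
    by (rule integral_Re[symmetric]) (rule integrable_iexp, auto)
  also have "\<dots> = (LINT x|lborel. std_normal_density x * cos (\<beta> * x))"
    by (subst integral_density) (auto simp: Re_exp)
  also have "\<dots> = sqrt a * (LINT \<phi>|lborel. std_normal_density (0 + sqrt a * \<phi>) * cos (\<beta> * (0 + sqrt a * \<phi>)))"
    using a by (subst lborel_integral_real_affine[of "sqrt a" _ 0]) auto
  finally have "exp (- (\<beta>\<^sup>2 / 2)) = sqrt a * (LINT \<phi>|lborel. std_normal_density (0 + sqrt a * \<phi>) * cos (b * \<phi>))"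
    using a by (simp add: \<beta>_def)
  moreover have "(LINT \<phi>|lborel. exp (- (a * \<phi>\<^sup>2 / 2)) * cos (b * \<phi>)) =
      sqrt (2 * pi) * (LINT \<phi>|lborel. std_normal_density (0 + sqrt a * \<phi>) * cos (b * \<phi>))"
    unfolding dens[symmetric] by (simp add: mult.assoc)
  moreover have "\<beta>\<^sup>2 / 2 = b\<^sup>2 / (2 * a)"
    using a by (simp add: \<beta>_def power_divide)
  ultimately show "(LINT \<phi>|lborel. exp (- (a * \<phi>\<^sup>2 / 2)) * cos (b * \<phi>)) = sqrt (2 * pi / a) * exp (- (b\<^sup>2 / (2 * a)))"
    using a by (simp add: real_sqrt_divide)
qed

lemma scaled_sine_tendsto:
  "((\<lambda>t. sqrt t * sin (c / sqrt t)) \<longlongrightarrow> c) at_top"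
proof -
  have "((\<lambda>x. sin (c * x)) has_real_derivative c) (at 0)"
    by (auto intro!: derivative_eq_intros)
  then have "((\<lambda>h. sin (c * h) / h) \<longlongrightarrow> c) (at 0)"
    by (simp add: DERIV_def)
  moreover have "filterlim (\<lambda>t. inverse (sqrt t)) (at 0) at_top"
    using filterlim_compose[OF filterlim_inverse_at_right_top sqrt_at_top]
    by (rule filterlim_mono) (auto simp: at_within_le_at)
  ultimately have "((\<lambda>t. sin (c * inverse (sqrt t)) / inverse (sqrt t)) \<longlongrightarrow> c) at_top"
    by (rule filterlim_compose)
  then show ?thesis
    by (simp add: field_simps)
qed

text \<open>The graph of the concave function \<open>sin\<close> lies above its chord over \<open>{0..\<pi> / 2}\<close>.\<close>

lemma jordan_sine_bound:
  fixes y :: real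
  assumes "\<bar>y\<bar> \<le> pi / 2"
  shows "2 / pi * \<bar>y\<bar> \<le> \<bar>sin y\<bar>"
proof -
  have concave: "concave_on {0..pi / 2} sin"
  proof (rule f''_le0_imp_concave[where f' = cos and f'' = "\<lambda>x. - sin x"])
    show "(cos has_real_derivative - sin x) (at x)" for x :: real
      by (auto intro!: derivative_eq_intros)
  qed (auto intro!: sin_ge_zero)
  have "2 / pi * \<bar>y\<bar> \<le> sin \<bar>y\<bar>"
    using concave_onD[OF concave, of "2 / pi * \<bar>y\<bar>" 0 "pi / 2"] assms by simp
  also have "sin \<bar>y\<bar> \<le> \<bar>sin y\<bar>"
    by (auto simp: abs_if)
  finally show ?thesis .
qed

lemma one_minus_cos: "1 - cos y = 2 * (sin (y / 2))\<^sup>2" for y :: real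
  using cos_double_sin[of "y / 2"] by simp

text \<open>The integrand of the kernel after the substitution \<open>\<theta> = \<phi> / \<surd>t\<close>, which magnifies the
  neighbourhood of the maximum of \<open>cos\<close>, and after multiplication by \<open>exp (- a t)\<close>, the reciprocal of
  the maximal value of \<open>exp (a t cos \<theta>)\<close>. The Jacobian \<open>1 / \<surd>t\<close> is what the factor \<open>\<surd>t\<close> in front of the
  kernel compensates.\<close>

definition laplace_integrand :: "real \<Rightarrow> nat \<Rightarrow> real \<Rightarrow> real \<Rightarrow> real \<Rightarrow> real" where
  "laplace_integrand a n p t \<phi> = indicator {-pi..pi} (\<phi> / sqrt t) * (cos (\<phi> / sqrt t) ^ n *
     exp (- (a * (t * (1 - cos (\<phi> / sqrt t))))) * cos (a * p * sin (\<phi> / sqrt t)))"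

lemma laplace_integrand_measurable [measurable]:
  "laplace_integrand a n p t \<in> borel_measurable borel"
  unfolding laplace_integrand_def by measurable

lemma scaled_bessel_kernel:
  assumes t: "t > 0"
  shows "sqrt t * exp (- (a * t)) * bessel_kernel a n 0 p t = (LINT \<phi>|lborel. laplace_integrand a n p t \<phi>) / (2 * pi)"
proof -
  let ?f = "\<lambda>\<theta>. cos \<theta> ^ n * exp (a * t * cos \<theta>) * cos (a * p * sin \<theta>)"
  have "set_integrable lborel {-pi..pi} ?f"
    by (intro borel_integrable_atLeastAtMost' continuous_intros)
  then have "integral {-pi..pi} ?f = (LINT \<theta>|lborel. indicator {-pi..pi} \<theta> * ?f \<theta>)"
    using set_borel_integral_eq_integral(2)[of "{-pi..pi}" ?f]
    by (simp add: set_lebesgue_integral_def)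
  also have "\<dots> = (LINT \<phi>|lborel. indicator {-pi..pi} (0 + inverse (sqrt t) * \<phi>) * ?f (0 + inverse (sqrt t) * \<phi>)) / sqrt t"
    using t by (subst lborel_integral_real_affine[of "inverse (sqrt t)" _ 0]) (auto simp: divide_inverse)
  also have "\<dots> = (LINT \<phi>|lborel. exp (a * t) * laplace_integrand a n p t \<phi>) / sqrt t"
    unfolding laplace_integrand_def
    by (intro arg_cong2[where f = "(/)"] Bochner_Integration.integral_cong refl)
       (auto simp: field_simps exp_diff)
  finally have eq: "integral {-pi..pi} ?f = exp (a * t) * (LINT \<phi>|lborel. laplace_integrand a n p t \<phi>) / sqrt t"
    by simp
  have "sqrt t * exp (- (a * t)) * bessel_kernel a n 0 p t = sqrt t * exp (- (a * t)) * integral {-pi..pi} ?f / (2 * pi)"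
    by (simp add: bessel_kernel_def)
  also have "\<dots> = (LINT \<phi>|lborel. laplace_integrand a n p t \<phi>) / (2 * pi)"
    unfolding eq using t by (simp add: exp_minus)
  finally show ?thesis .
qed

text \<open>The Gaussian majorant, uniform in \<open>t\<close> and \<open>p\<close>: on \<open>\<bar>\<theta>\<bar> \<le> \<pi>\<close> the bound
  \<open>1 - cos \<theta> = 2 sin\<^sup>2(\<theta> / 2) \<ge> 2 \<theta>\<^sup>2 / \<pi>\<^sup>2\<close> holds, so the exponent is at most \<open>- 2 a \<phi>\<^sup>2 / \<pi>\<^sup>2\<close>. The
  constant is written in the form \<open>exp (- c \<phi>\<^sup>2 / 2)\<close> of the Gaussian integral above.\<close>

lemma laplace_integrand_bound:
  assumes "a > 0" "t > 0"
  shows "\<bar>laplace_integrand a n p t \<phi>\<bar> \<le> exp (- (4 * a / pi\<^sup>2 * \<phi>\<^sup>2 / 2))"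
proof (cases "\<phi> / sqrt t \<in> {-pi..pi}")
  case True
  let ?\<theta> = "\<phi> / sqrt t"
  have "2 / pi * \<bar>?\<theta> / 2\<bar> \<le> \<bar>sin (?\<theta> / 2)\<bar>"
    using True by (intro jordan_sine_bound) (auto simp: abs_le_iff field_simps)
  then have "(2 / pi * \<bar>?\<theta> / 2\<bar>)\<^sup>2 \<le> \<bar>sin (?\<theta> / 2)\<bar>\<^sup>2"
    by (intro power_mono) auto
  then have "\<phi>\<^sup>2 / (pi\<^sup>2 * t) \<le> (sin (?\<theta> / 2))\<^sup>2"
    using assms by (simp add: power_mult_distrib power_divide)
  then have "2 * t * (\<phi>\<^sup>2 / (pi\<^sup>2 * t)) \<le> 2 * t * (sin (?\<theta> / 2))\<^sup>2"
    using assms by (intro mult_left_mono) auto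
  then have "2 * \<phi>\<^sup>2 / pi\<^sup>2 \<le> t * (1 - cos ?\<theta>)"
    using assms by (simp add: one_minus_cos mult_ac)
  then have "a * (2 * \<phi>\<^sup>2 / pi\<^sup>2) \<le> a * (t * (1 - cos ?\<theta>))"
    using assms by (intro mult_left_mono) auto
  then have e: "exp (- (a * (t * (1 - cos ?\<theta>)))) \<le> exp (- (4 * a / pi\<^sup>2 * \<phi>\<^sup>2 / 2))"
    by (simp add: mult.left_commute)
  have "\<bar>cos ?\<theta> ^ n\<bar> \<le> 1"
    by (simp add: power_abs power_le_one)
  then have "\<bar>cos ?\<theta> ^ n\<bar> * exp (- (a * (t * (1 - cos ?\<theta>)))) * \<bar>cos (a * p * sin ?\<theta>)\<bar>
      \<le> 1 * exp (- (4 * a / pi\<^sup>2 * \<phi>\<^sup>2 / 2)) * 1"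
    using e by (intro mult_mono) auto
  then show ?thesis
    using True by (simp add: laplace_integrand_def abs_mult)
qed (simp add: laplace_integrand_def)

text \<open>Every factor is governed by \<open>\<surd>t sin (c / \<surd>t) \<longlonglongrightarrow> c\<close>. The power of the cosine disappears
  in the limit, so differentiating the kernel in \<open>t\<close> only multiplies its asymptotics by \<open>a\<close>.\<close>

lemma laplace_integrand_tendsto:
  assumes p: "((\<lambda>t. p t / sqrt t) \<longlongrightarrow> x) at_top"
  shows "((\<lambda>t. laplace_integrand a n (p t) t \<phi>) \<longlongrightarrow> exp (- (a * \<phi>\<^sup>2 / 2)) * cos (a * x * \<phi>)) at_top"
proof -
  have small: "((\<lambda>t. \<phi> / sqrt t) \<longlongrightarrow> 0) at_top"
    by (intro real_tendsto_divide_at_top[OF tendsto_const] sqrt_at_top)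
  have "\<forall>\<^sub>F t in at_top. \<bar>\<phi> / sqrt t\<bar> < pi"
    using tendstoD[OF small pi_gt_zero] by (simp only: dist_real_def diff_0_right)
  then have ind: "\<forall>\<^sub>F t in at_top. indicator {-pi..pi} (\<phi> / sqrt t) = (1 :: real)"
    by eventually_elim (auto simp: indicator_def simp del: abs_divide)
  have c: "((\<lambda>t. cos (\<phi> / sqrt t) ^ n) \<longlongrightarrow> 1) at_top"
    using tendsto_power[OF tendsto_cos[OF small], of n] by simp
  have "((\<lambda>t. a * (2 * (sqrt t * sin (\<phi> / 2 / sqrt t))\<^sup>2)) \<longlongrightarrow> a * (2 * (\<phi> / 2)\<^sup>2)) at_top"
    by (intro tendsto_intros scaled_sine_tendsto)
  moreover have "\<forall>\<^sub>F t in at_top. a * (2 * (sqrt t * sin (\<phi> / 2 / sqrt t))\<^sup>2) = a * (t * (1 - cos (\<phi> / sqrt t)))"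
    using eventually_gt_at_top[of 0]
    by eventually_elim (simp add: one_minus_cos power_mult_distrib field_simps)
  ultimately have e: "((\<lambda>t. a * (t * (1 - cos (\<phi> / sqrt t)))) \<longlongrightarrow> a * \<phi>\<^sup>2 / 2) at_top"
    by (subst (asm) tendsto_cong) (auto simp: power_divide)
  have "((\<lambda>t. a * (p t / sqrt t) * (sqrt t * sin (\<phi> / sqrt t))) \<longlongrightarrow> a * x * \<phi>) at_top"
    by (intro tendsto_intros p scaled_sine_tendsto)
  moreover have "\<forall>\<^sub>F t in at_top. a * (p t / sqrt t) * (sqrt t * sin (\<phi> / sqrt t)) = a * p t * sin (\<phi> / sqrt t)"
    using eventually_gt_at_top[of 0] by eventually_elim simp
  ultimately have s: "((\<lambda>t. a * p t * sin (\<phi> / sqrt t)) \<longlongrightarrow> a * x * \<phi>) at_top"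
    by (subst (asm) tendsto_cong)
  have "((\<lambda>t. indicator {-pi..pi} (\<phi> / sqrt t) * (cos (\<phi> / sqrt t) ^ n *
      exp (- (a * (t * (1 - cos (\<phi> / sqrt t))))) * cos (a * p t * sin (\<phi> / sqrt t))))
    \<longlongrightarrow> 1 * (1 * exp (- (a * \<phi>\<^sup>2 / 2)) * cos (a * x * \<phi>))) at_top"
    by (intro tendsto_mult tendsto_exp tendsto_minus tendsto_cos c e s tendsto_eventually[OF ind])
  then show ?thesis
    by (simp add: laplace_integrand_def)
qed

text \<open>Laplace's method: dominated convergence for the rescaled integrand. The limit depends on
  \<open>p\<close> only through \<open>x = lim p t / \<surd>t\<close>, hence is blind to bounded shifts of \<open>p\<close>.\<close>

lemma bessel_kernel_asymptotics:
  assumes a: "a > 0" and p: "((\<lambda>t. p t / sqrt t) \<longlongrightarrow> x) at_top"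
  shows "((\<lambda>t. sqrt t * exp (- (a * t)) * bessel_kernel a n 0 (p t) t)
           \<longlongrightarrow> exp (- (a * x\<^sup>2 / 2)) / sqrt (2 * pi * a)) at_top"
proof -
  have "((\<lambda>t. LINT \<phi>|lborel. laplace_integrand a n (p t) t \<phi>)
      \<longlongrightarrow> (LINT \<phi>|lborel. exp (- (a * \<phi>\<^sup>2 / 2)) * cos (a * x * \<phi>))) at_top"
  proof (rule integral_dominated_convergence_at_top)
    show "integrable lborel (\<lambda>\<phi>. exp (- (4 * a / pi\<^sup>2 * \<phi>\<^sup>2 / 2)))"
      using a by (intro gaussian_cos_integral) simp
    show "\<forall>\<^sub>F t in at_top. AE \<phi> in lborel. norm (laplace_integrand a n (p t) t \<phi>) \<le> exp (- (4 * a / pi\<^sup>2 * \<phi>\<^sup>2 / 2))"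
      using eventually_gt_at_top[of 0]
      by eventually_elim (unfold real_norm_def, intro AE_I2 laplace_integrand_bound a)
  qed (use laplace_integrand_tendsto[OF p] in auto)
  then have "((\<lambda>t. (LINT \<phi>|lborel. laplace_integrand a n (p t) t \<phi>) / (2 * pi))
      \<longlongrightarrow> sqrt (2 * pi / a) * exp (- ((a * x)\<^sup>2 / (2 * a))) / (2 * pi)) at_top"
    unfolding gaussian_cos_integral(2)[OF a] by (intro tendsto_intros) auto
  moreover have "sqrt (2 * pi / a) * exp (- ((a * x)\<^sup>2 / (2 * a))) / (2 * pi) =
      exp (- (a * x\<^sup>2 / 2)) / sqrt (2 * pi * a)"
  proof -
    have scale: "sqrt (2 * pi / a) / (2 * pi) = 1 / sqrt (2 * pi * a)"
      using a by (simp add: real_sqrt_divide real_sqrt_mult field_simps)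
    have exponent: "(a * x)\<^sup>2 / (2 * a) = a * x\<^sup>2 / 2"
      using a by (simp add: power2_eq_square)
    have "sqrt (2 * pi / a) * exp (- ((a * x)\<^sup>2 / (2 * a))) / (2 * pi) =
        sqrt (2 * pi / a) / (2 * pi) * exp (- ((a * x)\<^sup>2 / (2 * a)))"
      by simp
    also have "\<dots> = 1 / sqrt (2 * pi * a) * exp (- (a * x\<^sup>2 / 2))"
      by (simp only: scale exponent)
    finally show ?thesis
      by simp
  qed
  ultimately have "((\<lambda>t. (LINT \<phi>|lborel. laplace_integrand a n (p t) t \<phi>) / (2 * pi))
      \<longlongrightarrow> exp (- (a * x\<^sup>2 / 2)) / sqrt (2 * pi * a)) at_top"
    by simp
  moreover have "\<forall>\<^sub>F t in at_top. (LINT \<phi>|lborel. laplace_integrand a n (p t) t \<phi>) / (2 * pi) =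
      sqrt t * exp (- (a * t)) * bessel_kernel a n 0 (p t) t"
    using eventually_gt_at_top[of 0] by eventually_elim (simp add: scaled_bessel_kernel)
  ultimately show ?thesis
    by (rule Lim_transform_eventually)
qed

text \<open>A bound uniform in the position, which serves as dominating constant when the kernel is
  integrated against the initial data.\<close>

lemma bessel_kernel_bound:
  assumes a: "a > 0"
  obtains C where "\<And>t p. t > 0 \<Longrightarrow> \<bar>sqrt t * exp (- (a * t)) * bessel_kernel a n 0 p t\<bar> \<le> C"
proof
  fix t p :: real assume t: "t > 0"
  let ?G = "\<lambda>\<phi>. exp (- (4 * a / pi\<^sup>2 * \<phi>\<^sup>2 / 2))"
  have G: "integrable lborel ?G"
    using a by (intro gaussian_cos_integral) simp
  have bound: "norm (laplace_integrand a n p t \<phi>) \<le> ?G \<phi>" for \<phi>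
    unfolding real_norm_def by (rule laplace_integrand_bound[OF a t])
  have "integrable lborel (laplace_integrand a n p t)"
    by (intro Bochner_Integration.integrable_bound[OF G] AE_I2 order_trans[OF bound]) auto
  then have "norm (LINT \<phi>|lborel. laplace_integrand a n p t \<phi>) \<le> (LINT \<phi>|lborel. ?G \<phi>)"
    by (rule Bochner_Integration.integral_norm_bound_integral[OF _ G bound])
  then show "\<bar>sqrt t * exp (- (a * t)) * bessel_kernel a n 0 p t\<bar> \<le> (LINT \<phi>|lborel. ?G \<phi>) / (2 * pi)"
    by (simp add: scaled_bessel_kernel[OF t] divide_right_mono)
qed

section \<open>Application to the damped wave equation\<close>

text \<open>With \<open>a = \<mu> / 2\<close>, the substitution \<open>w = exp (a t) u\<close> removes the damping term and turns the
  equation into \<open>w\<^sub>t\<^sub>t = w\<^sub>x\<^sub>x + a\<^sup>2 w\<close>, with initial velocity \<open>g + a f\<close>.\<close>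
lemma damped_wave_representation:
  assumes \<mu>: "\<mu> > 0" and sol: "damped_wave_solution \<mu> f g u" and t: "t > 0"
  defines "a \<equiv> \<mu> / 2"
  shows "2 * exp (a * t) * u x t =
    f (x + t) * bessel_kernel a 0 0 t t + f (x - t) * bessel_kernel a 0 0 t t +
    integral {x - t..x + t} (\<lambda>z. (g z + a * f z) * bessel_kernel a 0 0 (x - z) t
                               + f z * (a * bessel_kernel a 1 0 (x - z) t))"
proof -
  have a: "a > 0"
    using \<mu> by (simp add: a_def)
  have pde: "\<mu> * dt u y s + dt (dt u) y s - dx (dx u) y s = 0" if "s > 0" for y s
    using sol that by (simp add: damped_wave_solution_def)
  have init: "u y 0 = f y" "dt u y 0 = g y" for y
    using sol by (auto simp: damped_wave_solution_def)
  have C2: "C_k_halfplane (Suc (Suc 0)) u"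
    using sol by (simp add: damped_wave_solution_def numeral_2_eq_2)
  have cont: "continuous_on (UNIV \<times> {0..}) (\<lambda>p. u (fst p) (snd p))"
    "continuous_on (UNIV \<times> {0..}) (\<lambda>p. dx u (fst p) (snd p))"
    "continuous_on (UNIV \<times> {0..}) (\<lambda>p. dt u (fst p) (snd p))"
    "continuous_on (UNIV \<times> {0..}) (\<lambda>p. dx (dx u) (fst p) (snd p))"
    using C2 by (simp_all add: case_prod_beta')
  have space: "((\<lambda>z. h z s) has_real_derivative dx h y s) (at y)"
    if "(\<lambda>z. h z s) differentiable (at y)" for h y s
    using that by (simp add: dx_def DERIV_deriv_iff_real_differentiable)
  have time: "(h y has_real_derivative dt h y s) (at s)"
    if "(\<lambda>s. h y s) differentiable (at s within {0..})" "s > 0" for h y s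
  proof -
    have "at s within {0..} = at s"
      by (rule at_within_interior) (use that(2) in simp)
    then show ?thesis
      using that(1) vector_derivative_works[of "h y" "at s within {0..}"]
      by (simp add: dt_def has_real_derivative_iff_has_vector_derivative)
  qed
  have ux: "((\<lambda>z. u z s) has_real_derivative dx u y s) (at y)"
    and uxx: "((\<lambda>z. dx u z s) has_real_derivative dx (dx u) y s) (at y)" if "s \<ge> 0" for y s
    using C2 that by (auto intro!: space)
  have ut: "(u y has_real_derivative dt u y s) (at s)"
    and utt: "(dt u y has_real_derivative dt (dt u) y s) (at s)" if "s > 0" for y s
    using C2 that by (auto intro!: time)
  have "2 * (exp (a * t) * u x t) =
    exp (a * 0) * u (x + t) 0 * bessel_kernel a 0 0 t t + exp (a * 0) * u (x - t) 0 * bessel_kernel a 0 0 t t +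
    integral {x - t..x + t} (\<lambda>z. exp (a * 0) * (dt u z 0 + a * u z 0) * bessel_kernel a 0 0 (x - z) t
                               + exp (a * 0) * u z 0 * (a * bessel_kernel a 1 0 (x - z) t))"
  proof (rule riemann_representation[OF a, where w = "\<lambda>y s. exp (a * s) * u y s"
        and w\<^sub>x = "\<lambda>y s. exp (a * s) * dx u y s" and w\<^sub>x\<^sub>x = "\<lambda>y s. exp (a * s) * dx (dx u) y s"
        and w\<^sub>t = "\<lambda>y s. exp (a * s) * (dt u y s + a * u y s)"
        and w\<^sub>t\<^sub>t = "\<lambda>y s. exp (a * s) * (dt (dt u) y s + 2 * a * dt u y s + a\<^sup>2 * u y s)"])
    fix y s :: real
    show "((\<lambda>z. exp (a * s) * u z s) has_real_derivative exp (a * s) * dx u y s) (at y)" if "0 \<le> s"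
      by (intro DERIV_cmult ux that)
    show "((\<lambda>z. exp (a * s) * dx u z s) has_real_derivative exp (a * s) * dx (dx u) y s) (at y)" if "0 \<le> s"
      by (intro DERIV_cmult uxx that)
    assume s: "s > 0"
    show "((\<lambda>s. exp (a * s) * u y s) has_real_derivative exp (a * s) * (dt u y s + a * u y s)) (at s)"
      by (auto intro!: derivative_eq_intros ut[OF s] simp: algebra_simps)
    show "((\<lambda>s. exp (a * s) * (dt u y s + a * u y s)) has_real_derivative
        exp (a * s) * (dt (dt u) y s + 2 * a * dt u y s + a\<^sup>2 * u y s)) (at s)"
      by (auto intro!: derivative_eq_intros ut[OF s] utt[OF s] simp: algebra_simps power2_eq_square)
    have eq: "dx (dx u) y s = dt (dt u) y s + 2 * a * dt u y s"
      using pde[OF s, of y] by (simp add: a_def)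
    show "exp (a * s) * (dt (dt u) y s + 2 * a * dt u y s + a\<^sup>2 * u y s) =
        exp (a * s) * dx (dx u) y s + a\<^sup>2 * (exp (a * s) * u y s)"
      unfolding eq by (simp add: algebra_simps)
  next
    show "t > 0" by (rule t)
  qed (unfold case_prod_beta', (intro continuous_intros cont)+)
  then show ?thesis
    by (simp add: init)
qed

lemma C_k_compact_continuous:
  "f \<in> C_k_compact k \<Longrightarrow> continuous_on UNIV f"
  by (cases k) (auto simp: C_k_compact_def intro: differentiable_imp_continuous_on)

lemma C_k_compact_vanishes:
  assumes "f \<in> C_k_compact k"
  obtains L where "\<And>z. \<bar>z\<bar> > L \<Longrightarrow> f z = 0"
proof -
  have "bounded (closure (support_on UNIV f))"
    using assms compact_imp_bounded by (auto simp: C_k_compact_def)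
  then obtain L where L: "\<forall>z \<in> closure (support_on UNIV f). norm z \<le> L"
    by (auto simp: bounded_iff)
  have "f z = 0" if "\<bar>z\<bar> > L" for z
  proof (rule ccontr)
    assume "f z \<noteq> 0"
    then have "z \<in> closure (support_on UNIV f)"
      using closure_subset by (force simp: support_on_def)
    with L that show False
      by auto
  qed
  then show ?thesis
    using that by blast
qed

text \<open>Bridges the Henstock-Kurzweil integral over the base of the characteristic triangle and the
  Lebesgue integral over the whole line, which allows dominated convergence.\<close>

lemma integral_of_supported:
  fixes h :: "real \<Rightarrow> real"
  assumes cont: "continuous_on UNIV h" and supp: "\<And>z. z \<notin> {b..c} \<Longrightarrow> h z = 0"
  shows "integrable lborel h" and "integral {b..c} h = (LINT z|lborel. h z)"
proof -
  have ind: "(\<lambda>z. indicator {b..c} z *\<^sub>R h z) = h"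
    using supp by (auto simp: fun_eq_iff indicator_def)
  have "set_integrable lborel {b..c} h"
    by (intro borel_integrable_atLeastAtMost' continuous_on_subset[OF cont]) auto
  then show "integrable lborel h" "integral {b..c} h = (LINT z|lborel. h z)"
    using set_borel_integral_eq_integral(2)[of "{b..c}" h]
    by (simp_all add: set_integrable_def set_lebesgue_integral_def ind del: real_scaleR_def)
qed

theorem theorem1p1:
  fixes \<mu> :: real
    and f g :: "real \<Rightarrow> real"
    and u :: "real \<Rightarrow> real \<Rightarrow> real"
    and x M :: real
  assumes "\<mu> > 0"
    and "f \<in> C_k_compact 2"
    and "g \<in> C_k_compact 1"
    and "damped_wave_solution \<mu> f g u"
    and "M = (LINT y|lborel. f y + (1 / \<mu>) * g y)"
  shows "((\<lambda>t. sqrt t * u (sqrt t * x) t) \<longlongrightarrow> M * f_star \<mu> x) at_top"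
proof -
  define a where "a = \<mu> / 2"
  have a: "a > 0"
    using assms(1) by (simp add: a_def)
  note contf = C_k_compact_continuous[OF assms(2)] and contg = C_k_compact_continuous[OF assms(3)]
  obtain L1 where L1: "\<And>z. \<bar>z\<bar> > L1 \<Longrightarrow> f z = 0"
    using C_k_compact_vanishes[OF assms(2)] by blast
  obtain L2 where L2: "\<And>z. \<bar>z\<bar> > L2 \<Longrightarrow> g z = 0"
    using C_k_compact_vanishes[OF assms(3)] by blast
  define L where "L = max L1 L2"
  have vanish: "f z = 0" "g z = 0" if "z \<notin> {- L..L}" for z
    using L1[of z] L2[of z] that by (auto simp: L_def)
  \<comment> \<open>\<open>E\<close> is the rescaled kernel, \<open>H\<close> its pairing with the data, \<open>\<kappa>\<close> the common limit of \<open>E 0\<close> and \<open>E 1\<close>.\<close>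
  define E where "E n t z = sqrt t * exp (- (a * t)) * bessel_kernel a n 0 (sqrt t * x - z) t" for n t z
  define H where "H t z = (g z + a * f z) * E 0 t z + a * f z * E 1 t z" for t z
  define \<kappa> where "\<kappa> = exp (- (a * x\<^sup>2 / 2)) / sqrt (2 * pi * a)"
  have contE: "continuous_on UNIV (E n t)" for n t
    unfolding E_def by (intro continuous_intros)
  have contH: "continuous_on UNIV (H t)" for t
    unfolding H_def by (intro continuous_intros contf contg contE[THEN continuous_on_compose2]) auto
  have E_lim: "((\<lambda>t. E n t z) \<longlongrightarrow> \<kappa>) at_top" for n z
    unfolding E_def \<kappa>_def
  proof (rule bessel_kernel_asymptotics[OF a])
    have "((\<lambda>t. x - z / sqrt t) \<longlongrightarrow> x - 0) at_top"
      by (intro tendsto_intros real_tendsto_divide_at_top[OF tendsto_const] sqrt_at_top)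
    moreover have "\<forall>\<^sub>F t in at_top. x - z / sqrt t = (sqrt t * x - z) / sqrt t"
      using eventually_gt_at_top[of 0] by eventually_elim (simp add: field_simps)
    ultimately show "((\<lambda>t. (sqrt t * x - z) / sqrt t) \<longlongrightarrow> x) at_top"
      by (simp add: tendsto_cong)
  qed
  obtain C0 where C0: "\<And>t p. t > 0 \<Longrightarrow> \<bar>sqrt t * exp (- (a * t)) * bessel_kernel a 0 0 p t\<bar> \<le> C0"
    using bessel_kernel_bound[OF a, of 0] by blast
  obtain C1 where C1: "\<And>t p. t > 0 \<Longrightarrow> \<bar>sqrt t * exp (- (a * t)) * bessel_kernel a 1 0 p t\<bar> \<le> C1"
    using bessel_kernel_bound[OF a, of 1] by blast
  define C where "C = max C0 C1"
  have C: "\<bar>E 0 t z\<bar> \<le> C" "\<bar>E 1 t z\<bar> \<le> C" if "t > 0" for t z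
    using C0[OF that] C1[OF that] by (simp_all add: E_def C_def le_max_iff_disj)
  have lim: "((\<lambda>t. LINT z|lborel. H t z) \<longlongrightarrow> (LINT z|lborel. (g z + a * f z) * \<kappa> + a * f z * \<kappa>)) at_top"
  proof (rule integral_dominated_convergence_at_top)
    show "integrable lborel (\<lambda>z. (\<bar>g z + a * f z\<bar> + \<bar>a * f z\<bar>) * C)"
      by (rule integral_of_supported(1)[where b = "- L" and c = L])
         (auto intro!: continuous_intros contf contg simp: vanish)
    show "\<forall>\<^sub>F t in at_top. AE z in lborel. norm (H t z) \<le> (\<bar>g z + a * f z\<bar> + \<bar>a * f z\<bar>) * C"
      using eventually_gt_at_top[of 0]
    proof eventually_elim
      case (elim t)
      have "norm (H t z) \<le> \<bar>g z + a * f z\<bar> * C + \<bar>a * f z\<bar> * C" for z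
        unfolding H_def real_norm_def abs_mult[symmetric]
        by (rule order_trans[OF abs_triangle_ineq], unfold abs_mult, intro add_mono mult_left_mono C elim) auto
      then show ?case
        by (simp add: distrib_right)
    qed
    show "AE z in lborel. ((\<lambda>t. H t z) \<longlongrightarrow> (g z + a * f z) * \<kappa> + a * f z * \<kappa>) at_top"
      unfolding H_def by (intro AE_I2 tendsto_intros E_lim)
  qed (auto intro!: borel_measurable_continuous_onI contH continuous_intros contf contg)
  have rep: "\<forall>\<^sub>F t in at_top. (LINT z|lborel. H t z) / 2 = sqrt t * u (sqrt t * x) t"
  proof -
    \<comment> \<open>From this time on the base of the triangle with apex \<open>(\<surd>t x, t)\<close> covers the support of the
      data, because \<open>\<surd>t (\<bar>x\<bar> + \<bar>L\<bar>) < t\<close>; in particular its endpoints contribute nothing.\<close>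
    have "\<forall>\<^sub>F t in at_top. sqrt t > \<bar>x\<bar> + \<bar>L\<bar> + 1"
      using sqrt_at_top by (simp add: filterlim_at_top_dense)
    then show ?thesis
      using eventually_gt_at_top[of 0]
    proof eventually_elim
      case (elim t)
      define y where "y = sqrt t * x"
      have y: "\<bar>y\<bar> + \<bar>L\<bar> < t"
      proof -
        have "\<bar>L\<bar> \<le> sqrt t * \<bar>L\<bar>"
          using elim mult_right_mono[of 1 "sqrt t" "\<bar>L\<bar>"] by linarith
        moreover have "sqrt t * (\<bar>x\<bar> + \<bar>L\<bar>) < sqrt t * sqrt t"
          using elim by (intro mult_strict_left_mono) auto
        ultimately show ?thesis
          using elim by (simp add: y_def abs_mult algebra_simps)
      qed
      have f0: "f (y + t) = 0" "f (y - t) = 0"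
        using y by (auto intro!: vanish)
      have out: "z \<notin> {- L..L}" if "z \<notin> {y - t..y + t}" for z
        using y that by auto
      have "(LINT z|lborel. H t z) = integral {y - t..y + t} (H t)"
        by (rule integral_of_supported(2)[symmetric, OF contH]) (simp add: H_def vanish[OF out])
      also have "\<dots> = integral {y - t..y + t} (\<lambda>z. (sqrt t * exp (- (a * t))) *
          ((g z + a * f z) * bessel_kernel a 0 0 (y - z) t + f z * (a * bessel_kernel a 1 0 (y - z) t)))"
        by (intro integral_cong) (simp add: H_def E_def y_def algebra_simps)
      also have "\<dots> = sqrt t * exp (- (a * t)) * (2 * exp (a * t) * u y t)"
        using damped_wave_representation[OF assms(1,4) elim(2), of y] by (simp add: f0 a_def)
      finally show ?case
        by (simp add: y_def exp_minus)
    qed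
  qed
  have "((\<lambda>t. (LINT z|lborel. H t z) / 2) \<longlongrightarrow> (LINT z|lborel. (g z + a * f z) * \<kappa> + a * f z * \<kappa>) / 2) at_top"
    by (intro tendsto_divide lim tendsto_const) simp
  then have "((\<lambda>t. sqrt t * u (sqrt t * x) t) \<longlongrightarrow> (LINT z|lborel. (g z + a * f z) * \<kappa> + a * f z * \<kappa>) / 2) at_top"
    using rep by (rule Lim_transform_eventually)
  moreover have "(LINT z|lborel. (g z + a * f z) * \<kappa> + a * f z * \<kappa>) / 2 = M * f_star \<mu> x"
  proof -
    \<comment> \<open>The two contributions add up to \<open>g + 2 a f = \<mu> (f + g / \<mu>)\<close>.\<close>
    have "(LINT z|lborel. (g z + a * f z) * \<kappa> + a * f z * \<kappa>) = (LINT z|lborel. (f z + (1 / \<mu>) * g z) * (\<mu> * \<kappa>))"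
      using assms(1) by (intro Bochner_Integration.integral_cong) (simp_all add: a_def distrib_left distrib_right)
    also have "\<dots> = M * (\<mu> * \<kappa>)"
      by (simp add: assms(5))
    also have "\<mu> * \<kappa> = 2 * f_star \<mu> x"
    proof -
      have "\<mu> / sqrt (2 * pi * a) = \<mu> / (sqrt \<mu> * sqrt pi)"
        by (simp add: a_def real_sqrt_mult mult.commute)
      also have "\<dots> = sqrt \<mu> / sqrt pi"
        using assms(1) by (metis divide_divide_eq_left less_imp_le real_div_sqrt)
      also have "\<dots> = 2 * sqrt (\<mu> / (4 * pi))"
        by (simp add: real_sqrt_divide real_sqrt_mult)
      finally have "\<mu> / sqrt (2 * pi * a) * exp (- (a * x\<^sup>2 / 2)) = 2 * sqrt (\<mu> / (4 * pi)) * exp (- (a * x\<^sup>2 / 2))"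
        by (rule arg_cong)
      then show ?thesis
        by (simp add: \<kappa>_def f_star_def a_def)
    qed
    finally show ?thesis
      by simp
  qed
  ultimately show ?thesis
    by simp
qed

end
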